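(* Consider a circuit in the class RLCM$c$ (described in the context, with all memristor and topological assumptions stated there), so that each of the $n_C$ capacitors has a flux-controlled memristor in parallel and each of the $n_L$ inductors has a charge-controlled memristor in series. Let $$H_{\alpha\alpha}=A_{CR}R_{\mathcal L}^{-1}A_{CR}^\top,\quad H_{\alpha\beta}=A_{CL},\quad H_{\beta\beta}=A_{RL}^\top R_{\mathcal T}A_{RL},\quad H=\begin{pmatrix} H_{\alpha\alpha} & H_{\alpha\beta} \\ -H_{\alpha\beta}^\top & H_{\beta\beta} \end{pmatrix}.$$ For $i=1,\dots,n_C$ let $\rho_{Mi}=\inf_{\Phi\in\mathbb R}\hat Q_{Mi}'(\Phi)\ge0$, and for $j=1,\dots,n_L$ let $\gamma_{Mj}=\inf_{Q\in\mathbb R}\hat\Phi_{Mj}'(Q)\ge0$. Denoting by $\mu(\cdot)$ the least eigenvalue of a symmetric matrix, let $$\mu_1=\mu\big(L^{-1/2}(H_{\beta\beta}+\mathrm{diag}(\gamma_{M1},\dots,\gamma_{Mn_L}))L^{-1/2}\big),\qquad\mu_2=\mu\big(C^{-1/2}(H_{\alpha\alpha}+\mathrm{diag}(\rho_{M1},\dots,\rho_{Mn_C}))C^{-1/2}\big),$$ and suppose that $\mu_1+\mu_2>0$. Then, for any initial conditions $(v_{C0},i_{L0},\Phi_{MC0},Q_{ML0})$, any bounded solution of the state equations in the flux-charge domain $$\begin{pmatrix} C\dot\Phi_{MC} \\ L\dot Q_{ML} \end{pmatrix}=-H\begin{pmatrix} \Phi_{MC} \\ Q_{ML} \end{pmatrix}-\begin{pmatrix}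 \hat Q_{MC}(\Phi_{MC}) \\ \hat\Phi_{ML}(Q_{ML}) \end{pmatrix}+\begin{pmatrix} Q_0 \\ \Phi_0 \end{pmatrix},\qquad(\Phi_{MC},Q_{ML})\in\mathbb R^{n_C}\times\mathbb R^{n_L},$$ with the constant vectors $Q_0\in\mathbb R^{n_C}$, $\Phi_0\in\mathbb R^{n_L}$ defined from the initial conditions in the context, converges as $t\to+\infty$ to the set $E$ of equilibrium points of this system; moreover, it converges to a single point of $E$ when the equilibrium points are isolated.
   Context: Circuit. A connected digraph whose branches are: $n_C\ge1$ capacitive branches, each consisting of a capacitor $C_i>0$ in parallel with a flux-controlled memristor with characteristic $\hat Q_{Mi}:\mathbb R\to\mathbb R$; $n_L\ge1$ inductive branches, each consisting of an inductor $L_j>0$ in series with a charge-controlled memristor with characteristic $\hat\Phi_{Mj}:\mathbb R\to\mathbb R$; and linear resistors with resistances $R_i\ne0$ of either sign. Topological assumption. There is a spanning tree $\mathcal T$ with co-tree $\mathcal L$ such that all capacitive branches belong to $\mathcal T$ and the other branches of $\mathcal T$ are resistors; all inductive branches belong to $\mathcal L$ and the other branches of $\mathcal L$ are resistors; each resistor in $\mathcal L$ forms a (fundamental) loop exclusively with capacitive branches. Matrices. Kirchhoff's charge law for the fundamental cut-sets reads $q_{\mathcal T}+Aq_{\mathcal L}=0$, where $q_{\mathcal T},q_{\mathcal L}$ are the tree and co-tree branch charges and $A$ has entries in $\{-1,0,1\}$. Partition $A=\begin{pmatrix} A_{CL} & A_{CR} \\ A_{RL} & A_{RR} \end{pmatrix}$,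 with rows split into capacitive tree branches and tree resistors, and columns split into inductive co-tree branches and co-tree resistors (under the topological assumption $A_{RR}=0$). $R_{\mathcal T}$, $R_{\mathcal L}$ are the diagonal matrices of the resistances of the resistors in $\mathcal T$, $\mathcal L$; $C=\mathrm{diag}(C_1,\dots,C_{n_C})$, $L=\mathrm{diag}(L_1,\dots,L_{n_L})$; $\hat Q_{MC}$ and $\hat\Phi_{ML}$ act componentwise by the $\hat Q_{Mi}$ and $\hat\Phi_{Mj}$. Memristor assumptions. For each $i$: $\hat Q_{Mi}\in C^1(\mathbb R)$, $\hat Q_{Mi}(0)=0$, $\hat Q_{Mi}'\ge0$, and there exist $G_{mi}>0$, $\tilde\Phi_{Mi}>0$ with $\hat Q_{Mi}(\Phi)/\Phi\ge G_{mi}$ for $|\Phi|>\tilde\Phi_{Mi}$. For each $j$: $\hat\Phi_{Mj}\in C^1(\mathbb R)$, $\hat\Phi_{Mj}(0)=0$, $\hat\Phi_{Mj}'\ge0$, and there exist $R_{mj}>0$, $\tilde Q_{Mj}>0$ with $\hat\Phi_{Mj}(Q)/Q\ge R_{mj}$ for $|Q|>\tilde Q_{Mj}$. Constants. For initial capacitor voltages $v_{C0}\in\mathbb R^{n_C}$, inductor currents $i_{L0}\in\mathbb R^{n_L}$, memristor fluxes $\Phi_{MC0}\in\mathbb R^{n_C}$ and memristor charges $Q_{ML0}\in\mathbb R^{n_L}$: $Q_0=Cv_{C0}+H_{\alpha\alpha}\Phi_{MC0}+H_{\alpha\beta}Q_{ML0}+\hat Q_{MC}(\Phi_{MC0})$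 and $\Phi_0=Li_{L0}-H_{\alpha\beta}^\top\Phi_{MC0}+H_{\beta\beta}Q_{ML0}+\hat\Phi_{ML}(Q_{ML0})$. (Thus $Q_0,\Phi_0$ can be arbitrary vectors.) Convergence of a solution to a set means that its distance from the set tends to $0$ as $t\to+\infty$. *)

theory Defs
  imports "HOL-Analysis.Analysis" "Graph_Theory.Digraph_Component"
begin

section \<open>Undirected loops, spanning trees and cut-sets of a digraph\<close>

text \<open>
  \<^const>\<open>pre_digraph.cycle\<close> only sees directed cycles, and consequently
  \<^const>\<open>Digraph_Component.spanning_tree\<close> does not exclude undirected ones.  Loops of a
  circuit are undirected, so every branch is made traversable in both directions: the arc
  \<open>(e, True)\<close> follows the orientation of \<open>e\<close>, the arc \<open>(e, False)\<close> goes against it.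
\<close>

definition bidir :: "('v, 'e) pre_digraph \<Rightarrow> ('v, 'e \<times> bool) pre_digraph" where
  "bidir G = \<lparr> verts = verts G, arcs = arcs G \<times> UNIV,
     tail = (\<lambda>(e, fwd). if fwd then tail G e else head G e),
     head = (\<lambda>(e, fwd). if fwd then head G e else tail G e) \<rparr>"

text \<open>Distinctness of the branches rules out going back and forth along one branch.\<close>

definition undirected_loop :: "('v, 'e) pre_digraph \<Rightarrow> ('e \<times> bool) list \<Rightarrow> bool" where
  "undirected_loop G p \<longleftrightarrow> pre_digraph.cycle (bidir G) p \<and> distinct (map fst p)"

definition restrict_arcs :: "('v, 'e) pre_digraph \<Rightarrow> 'e set \<Rightarrow> ('v, 'e) pre_digraph" where
  "restrict_arcs G T = G\<lparr>arcs := T\<rparr>"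

text \<open>\<^const>\<open>Digraph_Component.connected\<close> is connectedness of the underlying undirected graph.\<close>

definition is_spanning_tree :: "('v, 'e) pre_digraph \<Rightarrow> 'e set \<Rightarrow> bool" where
  "is_spanning_tree G T \<longleftrightarrow>
     T \<subseteq> arcs G \<and> Digraph_Component.connected (restrict_arcs G T) \<and>
     (\<nexists>p. undirected_loop (restrict_arcs G T) p)"

text \<open>The branches on the fundamental loop that the co-tree branch \<open>l\<close> forms with the tree.\<close>

definition fundamental_loop :: "('v, 'e) pre_digraph \<Rightarrow> 'e set \<Rightarrow> 'e \<Rightarrow> 'e set" where
  "fundamental_loop G T l =
     \<Union> {fst ` set p | p. undirected_loop (restrict_arcs G (insert l T)) p \<and> l \<in> fst ` set p}"

text \<open>
  The side of the fundamental cut-set of the tree branch \<open>t\<close> that contains the tail of \<open>t\<close>.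
\<close>

definition cut_side :: "('v, 'e) pre_digraph \<Rightarrow> 'e set \<Rightarrow> 'e \<Rightarrow> 'v set" where
  "cut_side G T t = {v. tail G t \<rightarrow>\<^sup>*\<^bsub>with_proj (mk_symmetric (restrict_arcs G (T - {t})))\<^esub> v}"

text \<open>
  The cut-set is oriented along \<open>t\<close>, so the net charge leaving \<open>cut_side G T t\<close> vanishes in
  the form \<open>q t + (\<Sum>l\<in>arcs G - T. cut_matrix G T t l * q l) = 0\<close>.
\<close>

definition cut_matrix :: "('v, 'e) pre_digraph \<Rightarrow> 'e set \<Rightarrow> 'e \<Rightarrow> 'e \<Rightarrow> real" where
  "cut_matrix G T t l =
     (let S = cut_side G T t in
      if tail G l \<in> S \<and> head G l \<notin> S then 1
      else if tail G l \<notin> S \<and> head G l \<in> S then - 1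
      else 0)"


section \<open>Circuits\<close>

text \<open>
  Capacitive and inductive branches are indexed by the whole types \<open>'c\<close> and \<open>'l\<close>; as types
  are nonempty, there is at least one branch of each kind.  There may be no
  resistors at all; therefore they are not indexed by a whole type, but are those \<open>Resistor r\<close>
  which are arcs of the network.
\<close>

datatype ('c, 'l, 'r) branch = Capacitive 'c | Inductive 'l | Resistor 'r

record ('v, 'c, 'l, 'r) circuit =
  network :: "('v, ('c, 'l, 'r) branch) pre_digraph"
  capacitance :: "'c \<Rightarrow> real"
  inductance :: "'l \<Rightarrow> real"
  resistance :: "'r \<Rightarrow> real"
  Q_hat :: "'c \<Rightarrow> real \<Rightarrow> real"
  Phi_hat :: "'l \<Rightarrow> real \<Rightarrow> real"

definition memristor_characteristic :: "(real \<Rightarrow> real) \<Rightarrow> bool" where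
  "memristor_characteristic f \<longleftrightarrow>
     f C1_differentiable_on UNIV \<and> f 0 = 0 \<and> (\<forall>x. 0 \<le> deriv f x) \<and>
     (\<exists>g>0. \<exists>b>0. \<forall>x. \<bar>x\<bar> > b \<longrightarrow> f x / x \<ge> g)"

definition is_circuit :: "('v, 'c, 'l, 'r) circuit \<Rightarrow> bool" where
  "is_circuit N \<longleftrightarrow>
     fin_digraph (network N) \<and> Digraph_Component.connected (network N) \<and>
     range Capacitive \<subseteq> arcs (network N) \<and> range Inductive \<subseteq> arcs (network N) \<and>
     (\<forall>i. capacitance N i > 0) \<and> (\<forall>j. inductance N j > 0) \<and>
     (\<forall>r. Resistor r \<in> arcs (network N) \<longrightarrow> resistance N r \<noteq> 0) \<and>
     (\<forall>i. memristor_characteristic (Q_hat N i)) \<and>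
     (\<forall>j. memristor_characteristic (Phi_hat N j))"

definition tree_resistors ::
  "('v, 'c, 'l, 'r) circuit \<Rightarrow> ('c, 'l, 'r) branch set \<Rightarrow> 'r set" where
  "tree_resistors N T = {r. Resistor r \<in> T}"

definition cotree_resistors ::
  "('v, 'c, 'l, 'r) circuit \<Rightarrow> ('c, 'l, 'r) branch set \<Rightarrow> 'r set" where
  "cotree_resistors N T = {r. Resistor r \<in> arcs (network N) - T}"

definition is_circuit_tree ::
  "('v, 'c, 'l, 'r) circuit \<Rightarrow> ('c, 'l, 'r) branch set \<Rightarrow> bool" where
  "is_circuit_tree N T \<longleftrightarrow>
     is_spanning_tree (network N) T \<and>
     range Capacitive \<subseteq> T \<and> T \<inter> range Inductive = {} \<and>
     (\<forall>r \<in> cotree_resistors N T.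
        fundamental_loop (network N) T (Resistor r) - {Resistor r} \<subseteq> range Capacitive)"


section \<open>The matrices of the state equations\<close>

definition diagonal :: "('n::finite \<Rightarrow> real) \<Rightarrow> real^'n^'n" where
  "diagonal d = (\<chi> i j. if i = j then d i else 0)"

context
  fixes N :: "('v, 'c::finite, 'l::finite, 'r) circuit"
    and T :: "('c, 'l, 'r) branch set"
begin

definition A_CL :: "real^'l^'c" where
  "A_CL = (\<chi> i j. cut_matrix (network N) T (Capacitive i) (Inductive j))"

definition A_CR :: "'c \<Rightarrow> 'r \<Rightarrow> real" where
  "A_CR i r = cut_matrix (network N) T (Capacitive i) (Resistor r)"

definition A_RL :: "'r \<Rightarrow> 'l \<Rightarrow> real" where
  "A_RL r j = cut_matrix (network N) T (Resistor r) (Inductive j)"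

text \<open>
  The entries of the products \<open>A_CR R\<^sup>-\<^sup>1 A_CR\<^sup>T\<close> and \<open>A_RL\<^sup>T R A_RL\<close>, written out because
  the resistors do not form a type.
\<close>

definition H_aa :: "real^'c^'c" where
  "H_aa = (\<chi> i k. \<Sum>r\<in>cotree_resistors N T. A_CR i r * inverse (resistance N r) * A_CR k r)"

definition H_ab :: "real^'l^'c" where
  "H_ab = A_CL"

definition H_bb :: "real^'l^'l" where
  "H_bb = (\<chi> j k. \<Sum>r\<in>tree_resistors N T. A_RL r j * resistance N r * A_RL r k)"

text \<open>The block matrix \<open>H\<close> as a linear map.\<close>

definition H_mult :: "(real^'c) \<times> (real^'l) \<Rightarrow> (real^'c) \<times> (real^'l)" where
  "H_mult = (\<lambda>(\<Phi>, Q). (H_aa *v \<Phi> + H_ab *v Q, (- transpose H_ab) *v \<Phi> + H_bb *v Q))"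

definition Q_MC :: "real^'c \<Rightarrow> real^'c" where
  "Q_MC \<Phi> = (\<chi> i. Q_hat N i (\<Phi> $ i))"

definition Phi_ML :: "real^'l \<Rightarrow> real^'l" where
  "Phi_ML Q = (\<chi> j. Phi_hat N j (Q $ j))"

definition Q_const :: "real^'c \<Rightarrow> real^'c \<Rightarrow> real^'l \<Rightarrow> real^'c" where
  "Q_const v\<^sub>C\<^sub>0 \<Phi>\<^sub>0 Q\<^sub>0 =
     diagonal (capacitance N) *v v\<^sub>C\<^sub>0 + H_aa *v \<Phi>\<^sub>0 + H_ab *v Q\<^sub>0 + Q_MC \<Phi>\<^sub>0"

definition Phi_const :: "real^'l \<Rightarrow> real^'c \<Rightarrow> real^'l \<Rightarrow> real^'l" where
  "Phi_const i\<^sub>L\<^sub>0 \<Phi>\<^sub>0 Q\<^sub>0 =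
     diagonal (inductance N) *v i\<^sub>L\<^sub>0 - transpose H_ab *v \<Phi>\<^sub>0 + H_bb *v Q\<^sub>0 + Phi_ML Q\<^sub>0"


section \<open>State equations, solutions and equilibrium points\<close>

text \<open>Below, \<open>k\<close> is the pair \<open>(Q\<^sub>0, \<Phi>\<^sub>0)\<close> of the constant vectors.\<close>

definition state_rhs :: "(real^'c) \<times> (real^'l) \<Rightarrow> (real^'c) \<times> (real^'l) \<Rightarrow> (real^'c) \<times> (real^'l)" where
  "state_rhs k z = - H_mult z - (Q_MC (fst z), Phi_ML (snd z)) + k"

definition is_solution :: "(real^'c) \<times> (real^'l) \<Rightarrow> (real \<Rightarrow> (real^'c) \<times> (real^'l)) \<Rightarrow> bool" where
  "is_solution k z \<longleftrightarrow>
     (\<forall>t\<ge>0. \<exists>d\<Phi> dQ. (z has_vector_derivative (d\<Phi>, dQ)) (at t within {0..}) \<and>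
        (diagonal (capacitance N) *v d\<Phi>, diagonal (inductance N) *v dQ) = state_rhs k (z t))"

definition equilibria :: "(real^'c) \<times> (real^'l) \<Rightarrow> ((real^'c) \<times> (real^'l)) set" where
  "equilibria k = {z. state_rhs k z = 0}"

end

text \<open>
  \<^const>\<open>infdist\<close> to the empty set is 0 by convention, hence the first conjunct.
\<close>

definition converges_to_set :: "(real \<Rightarrow> 'a::metric_space) \<Rightarrow> 'a set \<Rightarrow> bool" where
  "converges_to_set z E \<longleftrightarrow> E \<noteq> {} \<and> ((\<lambda>t. infdist (z t) E) \<longlongrightarrow> 0) at_top"


section \<open>The spectral constants\<close>

definition is_eigenvalue :: "real^'n^'n \<Rightarrow> real \<Rightarrow> bool" where
  "is_eigenvalue M a \<longleftrightarrow> (\<exists>v. v \<noteq> 0 \<and> M *v v = a *\<^sub>R v)"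

definition least_eigenvalue :: "real^'n^'n \<Rightarrow> real" where
  "least_eigenvalue M = (LEAST a. is_eigenvalue M a)"

definition rho_M :: "('v, 'c, 'l, 'r) circuit \<Rightarrow> 'c \<Rightarrow> real" where
  "rho_M N i = (INF \<Phi>. deriv (Q_hat N i) \<Phi>)"

definition gamma_M :: "('v, 'c, 'l, 'r) circuit \<Rightarrow> 'l \<Rightarrow> real" where
  "gamma_M N j = (INF Q. deriv (Phi_hat N j) Q)"

definition mu1 ::
  "('v, 'c::finite, 'l::finite, 'r) circuit \<Rightarrow> ('c, 'l, 'r) branch set \<Rightarrow> real" where
  "mu1 N T =
     (let L = diagonal (\<lambda>j. inductance N j powr (- 1 / 2))
      in least_eigenvalue (L ** (H_bb N T + diagonal (gamma_M N)) ** L))"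

definition mu2 ::
  "('v, 'c::finite, 'l::finite, 'r) circuit \<Rightarrow> ('c, 'l, 'r) branch set \<Rightarrow> real" where
  "mu2 N T =
     (let C = diagonal (\<lambda>i. capacitance N i powr (- 1 / 2))
      in least_eigenvalue (C ** (H_aa N T + diagonal (rho_M N)) ** C))"

end

theory Submission
  imports Defs
begin

text \<open>
  Write the state equations as \<open>C x' = - \<nabla>a(x) - B y\<close>, \<open>L y' = B\<^sup>T x - \<nabla>b(y)\<close>. The energy of the
  velocities, \<open>V = (x' \<bullet> C x' + y' \<bullet> L y') / 2\<close>, satisfies
  \<open>V' \<le> - \<mu>\<^sub>2 (x' \<bullet> C x') - \<mu>\<^sub>1 (y' \<bullet> L y')\<close>, and the Brayton--Moser mixed potential
  \<open>P = a(x) - b(y) + x \<bullet> B y\<close> satisfies \<open>P' = y' \<bullet> L y' - x' \<bullet> C x'\<close>. Hence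
  \<open>V + (\<mu>\<^sub>1 - \<mu>\<^sub>2) P / 2\<close> decreases at rate at least \<open>(\<mu>\<^sub>1 + \<mu>\<^sub>2) V\<close>; it is bounded along a bounded
  solution, so \<open>V\<close> is integrable in time, and since \<open>V' \<le> K V\<close> it tends to 0. All cluster points of the
  solution are therefore equilibria, and a trajectory cannot move between isolated ones.
\<close>

section \<open>Functions decreasing at a rate bounded by a nonnegative function\<close>

text \<open>The growth bound \<open>v' \<le> K * v\<close> prevents \<open>v\<close> from rising
  suddenly: during the unit of time before \<open>t\<close> it is at least
  \<open>exp (- K) * v t\<close>. A large value of \<open>v t\<close> therefore costs
  \<open>w\<close> a proportional drop over that interval. Since \<open>w\<close> is nonincreasing
  and bounded below, such drops must become arbitrarily small.\<close>

lemma tendsto_0_of_dissipation: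
  fixes v w :: "real \<Rightarrow> real"
  assumes v: "\<And>t. t > 0 \<Longrightarrow> (v has_real_derivative v' t) (at t)" "\<And>t. t > 0 \<Longrightarrow> v' t \<le> K * v t"
    and w: "\<And>t. t > 0 \<Longrightarrow> (w has_real_derivative w' t) (at t)" "\<And>t. t > 0 \<Longrightarrow> w' t \<le> - c * v t"
    and pos: "c > 0" "K \<ge> 0" "\<And>t. t > 0 \<Longrightarrow> v t \<ge> 0"
    and bd: "bdd_below (w ` {0<..})"
  shows "(v \<longlongrightarrow> 0) at_top"
proof -
  have step: "c * exp (- K) * v t \<le> w (t - 1) - w t" if t: "t > 1" for t
  proof -
    have v_ge: "exp (- K) * v t \<le> v r" if r: "t - 1 \<le> r" "r \<le> t" for r
    proof -
      \<comment> \<open>Gronwall argument: with the integrating factor \<open>exp (- K * q)\<close>,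
        the growth bound says that the product has nonpositive derivative.\<close>
      have "exp (- K * t) * v t \<le> exp (- K * r) * v r"
      proof (rule DERIV_nonpos_imp_nonincreasing[OF r(2)])
        fix q assume q: "r \<le> q" "q \<le> t"
        then have "q > 0" using r t by linarith
        have "((\<lambda>q. exp (- K * q) * v q) has_real_derivative exp (- K * q) * (v' q - K * v q)) (at q)"
          using v(1)[OF \<open>q > 0\<close>]
          by (auto intro!: derivative_eq_intros simp: algebra_simps)
        moreover have "exp (- K * q) * (v' q - K * v q) \<le> 0"
          using v(2)[OF \<open>q > 0\<close>] by (simp add: mult_nonneg_nonpos)
        ultimately show "\<exists>y. ((\<lambda>q. exp (- K * q) * v q) has_real_derivative y) (at q) \<and> y \<le> 0"
          by blast
      qed
      then have "exp (K * r) * (exp (- K * t) * v t) \<le> exp (K * r) * (exp (- K * r) * v r)"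
        by (intro mult_left_mono) auto
      then have "exp (K * r - K * t) * v t \<le> v r"
        by (simp add: mult.assoc[symmetric] exp_add[symmetric])
      moreover have "exp (- K) * v t \<le> exp (K * r - K * t) * v t"
      proof (intro mult_right_mono)
        have "K * (t - r) \<le> K * 1" using r pos(2) by (intro mult_left_mono) auto
        then show "exp (- K) \<le> exp (K * r - K * t)" by (simp add: algebra_simps)
      qed (use pos(3) t in auto)
      ultimately show ?thesis by linarith
    qed
    \<comment> \<open>The mean value theorem takes the place of integrating \<open>w'\<close> over
      the unit interval, so no integrability of \<open>w'\<close> has to be established.\<close>
    have "\<exists>q. t - 1 < q \<and> q < t \<and> w t - w (t - 1) = (t - (t - 1)) * w' q"
      by (rule MVT2) (use w(1) t in auto)
    then obtain q where q: "t - 1 < q" "q < t" "w t - w (t - 1) = w' q"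
      by auto
    have "w' q \<le> - c * v q" using w(2) q t by auto
    moreover have "c * (exp (- K) * v t) \<le> c * v q"
      using v_ge[of q] q pos(1) by (intro mult_left_mono) auto
    ultimately show ?thesis using q(3) by (simp add: mult.assoc)
  qed
  have decr: "w b \<le> w a" if "0 < a" "a \<le> b" for a b
  proof (rule DERIV_nonpos_imp_nonincreasing[OF that(2)])
    fix q assume "a \<le> q" "q \<le> b"
    then have "q > 0" using that by linarith
    moreover have "w' q \<le> 0"
      using w(2)[OF \<open>q > 0\<close>] mult_nonneg_nonneg[of c "v q"] pos \<open>q > 0\<close> by fastforce
    ultimately show "\<exists>y. (w has_real_derivative y) (at q) \<and> y \<le> 0"
      using w(1) by blast
  qed
  define d where "d = c * exp (- K)"
  have d: "d > 0" using pos(1) by (simp add: d_def)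
  show ?thesis
  proof (rule tendstoI)
    fix e :: real assume e: "e > 0"
    \<comment> \<open>From \<open>t0\<close> on, \<open>w\<close> can lose less than
      \<open>d * e\<close>, because it is already that close to its infimum \<open>m\<close>. Times
      beyond \<open>t0 + 1\<close> are taken so that the whole interval from \<open>t - 1\<close> to
      \<open>t\<close> lies after \<open>t0\<close>.\<close>
    define m where "m = Inf (w ` {0<..})"
    have "m < m + d * e" using d e by simp
    then obtain t0 where t0: "t0 > 0" "w t0 < m + d * e"
      unfolding m_def using cInf_lessD[of "w ` {0<..}" "m + d * e"] by (auto simp: m_def)
    show "\<forall>\<^sub>F t in at_top. dist (v t) 0 < e"
      using eventually_gt_at_top[of "t0 + 1"]
    proof eventually_elim
      case (elim t)
      have "m \<le> w t" unfolding m_def using elim t0 by (intro cInf_lower bd) auto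
      moreover have "w (t - 1) \<le> w t0" using decr[of t0 "t - 1"] elim t0 by auto
      moreover have "d * v t \<le> w (t - 1) - w t" using step[of t] elim t0 by (simp add: d_def)
      ultimately have "d * v t < d * e" using t0 by linarith
      then show ?case using d pos(3)[of t] elim t0 by simp
    qed
  qed
qed

section \<open>Cluster points of bounded trajectories\<close>

text \<open>Bolzano--Weierstrass along times at which the trajectory visits \<open>S\<close>. The
  set \<open>S\<close> serves to locate the cluster point: the whole space gives existence, while a
  closed set without zeros of \<open>F\<close> yields a contradiction and so cannot be visited at
  arbitrarily late times.\<close>

lemma bounded_cluster_point:
  fixes z :: "real \<Rightarrow> 'a::heine_borel" and F :: "'a \<Rightarrow> 'b::real_normed_vector"
  assumes bd: "bounded (z ` {0..})" and F: "continuous_on UNIV F"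
    and lim: "((\<lambda>t. F (z t)) \<longlongrightarrow> 0) at_top"
    and S: "closed S" "\<exists>\<^sub>F t in at_top. z t \<in> S"
  shows "\<exists>p\<in>S. F p = 0 \<and> (\<forall>e>0. \<exists>\<^sub>F t in at_top. dist (z t) p < e)"
proof -
  have "\<forall>n. \<exists>t\<ge>real n. z t \<in> S"
    using S(2) by (auto simp: frequently_def eventually_at_top_linorder)
  then obtain \<tau> where \<tau>: "\<And>n. \<tau> n \<ge> real n" "\<And>n. z (\<tau> n) \<in> S" by metis
  have "bounded (range (z \<circ> \<tau>))"
    by (rule bounded_subset[OF bd]) (use \<tau>(1) in \<open>auto intro: order_trans[OF of_nat_0_le_iff]\<close>)
  then obtain p r where r: "strict_mono r" and p: "((z \<circ> \<tau>) \<circ> r) \<longlonglongrightarrow> p"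
    using bounded_imp_convergent_subsequence by blast
  have "filterlim \<tau> at_top sequentially"
    by (rule filterlim_at_top_mono[OF filterlim_real_sequentially]) (simp add: \<tau>(1))
  then have \<tau>r: "filterlim (\<lambda>n. \<tau> (r n)) at_top sequentially"
    using filterlim_compose[OF _ filterlim_subseq[OF r]] by blast
  have "p \<in> S" using closed_sequentially[OF S(1) _ p] \<tau>(2) by auto
  moreover have "F p = 0"
  proof (rule LIMSEQ_unique)
    have "isCont F p" using F continuous_on_eq_continuous_at by blast
    then show "(\<lambda>n. F (z (\<tau> (r n)))) \<longlonglongrightarrow> F p"
      using p by (auto simp: o_def intro: isCont_tendsto_compose)
    show "(\<lambda>n. F (z (\<tau> (r n)))) \<longlonglongrightarrow> 0"
      using filterlim_compose[OF lim \<tau>r] .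
  qed
  moreover have "\<exists>\<^sub>F t in at_top. dist (z t) p < e" if "e > 0" for e
  proof -
    have "\<forall>\<^sub>F n in sequentially. dist (z (\<tau> (r n))) p < e"
      using tendstoD[OF p that] by (simp add: o_def)
    then have "\<exists>\<^sub>F n in sequentially. dist (z (\<tau> (r n))) p < e"
      by (simp add: eventually_frequently)
    then show ?thesis
      using \<tau>r unfolding filterlim_iff frequently_def by blast
  qed
  ultimately show ?thesis by blast
qed

text \<open>Otherwise the trajectory would keep returning to the closed set of points at distance at
  least \<open>e\<close> from the zeros, and a cluster point there would itself be a zero.\<close>

lemma converges_to_zeros:
  fixes z :: "real \<Rightarrow> 'a::heine_borel" and F :: "'a \<Rightarrow> 'b::real_normed_vector"
  assumes bd: "bounded (z ` {0..})" and F: "continuous_on UNIV F"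
    and lim: "((\<lambda>t. F (z t)) \<longlongrightarrow> 0) at_top"
  shows "converges_to_set z {p. F p = 0}"
proof -
  let ?E = "{p. F p = 0}"
  note cluster = bounded_cluster_point[OF bd F lim]
  have "?E \<noteq> {}" using cluster[of UNIV] by auto
  moreover have "((\<lambda>t. infdist (z t) ?E) \<longlongrightarrow> 0) at_top"
  proof (rule tendstoI, rule ccontr)
    fix e :: real
    assume e: "e > 0" and "\<not> (\<forall>\<^sub>F t in at_top. dist (infdist (z t) ?E) 0 < e)"
    then have "\<exists>\<^sub>F t in at_top. z t \<in> {p. e \<le> infdist p ?E}"
      by (simp add: not_eventually not_less infdist_nonneg)
    moreover have "closed {p. e \<le> infdist p ?E}"
      by (intro closed_Collect_le continuous_intros)
    ultimately obtain p where "p \<in> ?E" "e \<le> infdist p ?E" using cluster by blast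
    then show False using e by simp
  qed
  ultimately show ?thesis by (simp add: converges_to_set_def)
qed

lemma tendsto_isolated_zero:
  fixes z :: "real \<Rightarrow> 'a::heine_borel" and F :: "'a \<Rightarrow> 'b::real_normed_vector"
  assumes z: "continuous_on {0..} z" and bd: "bounded (z ` {0..})" and F: "continuous_on UNIV F"
    and lim: "((\<lambda>t. F (z t)) \<longlongrightarrow> 0) at_top"
    and disc: "discrete {p. F p = 0}"
  shows "\<exists>p. F p = 0 \<and> (z \<longlongrightarrow> p) at_top"
proof -
  note cluster = bounded_cluster_point[OF bd F lim]
  obtain p where p: "F p = 0" "\<And>e. e > 0 \<Longrightarrow> \<exists>\<^sub>F t in at_top. dist (z t) p < e"
    using cluster[of UNIV] by auto
  obtain r where r: "r > 0" "\<And>q. F q = 0 \<Longrightarrow> dist p q < r \<Longrightarrow> q = p"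
    using disc p(1) by (auto simp: discrete_def isolated_in_dist_Ex_iff)
  have "(z \<longlongrightarrow> p) at_top"
  proof (rule tendstoI)
    fix e0 :: real assume "e0 > 0"
    \<comment> \<open>Halving \<open>r\<close> keeps the sphere of radius \<open>e\<close> strictly
      inside the ball in which \<open>p\<close> is the only zero.\<close>
    define e where "e = min e0 (r / 2)"
    have e: "e > 0" "e \<le> e0" "e < r" using \<open>e0 > 0\<close> r(1) by (auto simp: e_def)
    \<comment> \<open>A trajectory that keeps leaving the ball would have a second cluster point, a zero of
      \<open>F\<close>, on its sphere.\<close>
    have "\<not> (\<exists>\<^sub>F t in at_top. z t \<in> sphere p e)"
    proof
      assume "\<exists>\<^sub>F t in at_top. z t \<in> sphere p e"
      moreover have "closed (sphere p e)"
        unfolding sphere_def by (intro closed_Collect_eq continuous_intros)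
      ultimately obtain q where q: "dist p q = e" "F q = 0"
        using cluster[of "sphere p e"] by (auto simp del: closed_sphere)
      then show False using r(2)[of q] e by auto
    qed
    then obtain t1 where t1: "\<And>t. t \<ge> t1 \<Longrightarrow> dist p (z t) \<noteq> e"
      by (auto simp: frequently_def eventually_at_top_linorder)
    obtain t0 where t0: "t0 \<ge> max t1 0" "dist (z t0) p < e"
      using p(2)[OF e(1)] unfolding frequently_def eventually_at_top_linorder by (metis not_less)
    \<comment> \<open>After \<open>t1\<close> the sphere is never met, so by the intermediate value
      theorem a trajectory inside the ball at \<open>t0\<close> is trapped there.\<close>
    have "dist p (z t) < e" if tt0: "t \<ge> t0" for t
    proof (rule ccontr)
      assume "\<not> dist p (z t) < e"
      moreover have "continuous_on {t0..t} (\<lambda>t. dist p (z t))"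
        by (intro continuous_intros continuous_on_subset[OF z]) (use t0 in auto)
      ultimately obtain q where "t0 \<le> q" "q \<le> t" "dist p (z q) = e"
        using IVT'[of "\<lambda>t. dist p (z t)" t0 e t] t0 tt0 by (auto simp: dist_commute)
      then show False using t1[of q] t0 by auto
    qed
    then show "\<forall>\<^sub>F t in at_top. dist (z t) p < e0"
      using e(2) unfolding eventually_at_top_linorder dist_commute[of p] by fastforce
  qed
  then show ?thesis using p(1) by blast
qed

section \<open>Quadratic forms and the least eigenvalue\<close>

lemma diagonal_mult_vec [simp]: "(diagonal d *v u) $ i = d i * u $ i"
  by (simp add: diagonal_def matrix_vector_mult_def if_distrib[of "\<lambda>x. x * _"] cong: if_cong)

lemma diagonal_self_adjoint: "u \<bullet> (diagonal d *v v) = (diagonal d *v u) \<bullet> v"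
  by (simp add: inner_vec_def algebra_simps)

lemma transpose_diagonal [simp]: "transpose (diagonal d) = diagonal d"
  by (auto simp: transpose_def diagonal_def vec_eq_iff)

lemma diagonal_inverse_mult:
  assumes "\<And>i. d i > 0"
  shows "diagonal d *v (diagonal (\<lambda>i. inverse (d i)) *v u) = u"
    and "diagonal (\<lambda>i. inverse (d i)) *v (diagonal d *v u) = u"
proof -
  have "d i \<noteq> 0" for i using assms[of i] by simp
  then show "diagonal d *v (diagonal (\<lambda>i. inverse (d i)) *v u) = u"
    and "diagonal (\<lambda>i. inverse (d i)) *v (diagonal d *v u) = u"
    by (simp_all add: vec_eq_iff)
qed

lemma diagonal_quadratic_form: "u \<bullet> (diagonal d *v u) = (\<Sum>i\<in>UNIV. d i * (u $ i)\<^sup>2)"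
  by (simp add: inner_vec_def power2_eq_square mult.left_commute)

lemma diagonal_quadratic_form_ge_0:
  assumes "\<And>i. d i > 0"
  shows "u \<bullet> (diagonal d *v u) \<ge> 0"
  unfolding diagonal_quadratic_form
  by (intro sum_nonneg mult_nonneg_nonneg zero_le_power2 order.strict_implies_order[OF assms])

lemma diagonal_quadratic_form_eq_0_iff:
  assumes "\<And>i. d i > 0"
  shows "u \<bullet> (diagonal d *v u) = 0 \<longleftrightarrow> u = 0"
proof -
  have "d i \<noteq> 0" for i using assms[of i] by simp
  moreover have "(\<Sum>i\<in>UNIV. d i * (u $ i)\<^sup>2) = 0 \<longleftrightarrow> (\<forall>i\<in>UNIV. d i * (u $ i)\<^sup>2 = 0)"
    by (intro sum_nonneg_eq_0_iff finite mult_nonneg_nonneg zero_le_power2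
        order.strict_implies_order[OF assms])
  ultimately show ?thesis by (simp add: diagonal_quadratic_form vec_eq_iff)
qed

text \<open>A zero of a nonnegative form is a minimum, so the first variation vanishes there; in the
  direction \<open>M *v v\<close> it is twice the squared norm of \<open>M *v v\<close>.\<close>

lemma symmetric_psd_kernel:
  fixes M :: "real^'n^'n"
  assumes sym: "transpose M = M" and psd: "\<And>u. u \<bullet> (M *v u) \<ge> 0" and v: "v \<bullet> (M *v v) = 0"
  shows "M *v v = 0"
proof (rule ccontr)
  assume ne: "M *v v \<noteq> 0"
  define u where "u = M *v v"
  have sw: "v \<bullet> (M *v u) = u \<bullet> u"
    using sym by (metis dot_lmul_matrix inner_commute u_def vector_transpose_matrix)
  define a b where "a = u \<bullet> u" and "b = u \<bullet> (M *v u)"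
  have a: "a > 0" using ne by (simp add: a_def u_def)
  have b: "b \<ge> 0" using psd by (simp add: b_def)
  have q: "0 \<le> 2 * k * a + k\<^sup>2 * b" for k
  proof -
    have "(v + k *\<^sub>R u) \<bullet> (M *v (v + k *\<^sub>R u)) = 2 * k * a + k\<^sup>2 * b"
      using sw v by (simp add: a_def b_def u_def[symmetric] matrix_vector_right_distrib
          matrix_vector_mult_scaleR inner_add_left inner_add_right power2_eq_square algebra_simps)
    then show ?thesis using psd[of "v + k *\<^sub>R u"] by simp
  qed
  \<comment> \<open>The quadratic in \<open>k\<close> has its minimum at \<open>- a / b\<close>; the
    denominator \<open>b + 1\<close> still gives a negative value and also covers
    \<open>b = 0\<close>.\<close>
  have "0 \<le> 2 * (- a / (b + 1)) * a + (- a / (b + 1))\<^sup>2 * b" by (rule q)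
  also have "\<dots> = - (a\<^sup>2 * (b + 2)) / (b + 1)\<^sup>2"
  proof -
    have "b + 1 \<noteq> 0" using b by simp
    then show ?thesis by (simp add: divide_simps power2_eq_square) (simp add: algebra_simps)
  qed
  also have "\<dots> < 0" using a b by (simp add: divide_neg_pos)
  finally show False by simp
qed

text \<open>Rayleigh's principle. The form attains its minimum \<open>m\<close> over the unit sphere
  at some \<open>v\<close>; then \<open>M - m I\<close> is positive semidefinite and its form
  vanishes at \<open>v\<close>, so \<open>v\<close> is an eigenvector. Exhibiting this minimum is
  also what gives \<open>LEAST\<close> a meaning, as the reals are not well-ordered.\<close>

lemma least_eigenvalue_le:
  fixes M :: "real^'n^'n"
  assumes sym: "transpose M = M"
  shows "least_eigenvalue M * (u \<bullet> u) \<le> u \<bullet> (M *v u)"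
proof -
  let ?q = "\<lambda>u. u \<bullet> (M *v u)"
  have "\<exists>v\<in>sphere 0 1. \<forall>u\<in>sphere 0 1. ?q v \<le> ?q u"
  proof (rule continuous_attains_inf)
    show "sphere 0 1 \<noteq> ({} :: (real^'n) set)"
      by (simp add: set_eq_iff) (metis norm_axis_1)
    show "continuous_on (sphere 0 1) ?q"
      by (intro continuous_on_inner continuous_on_id linear_continuous_on
          matrix_vector_mul_bounded_linear)
  qed simp
  then obtain v where v: "norm v = 1" and v_min: "\<And>u. norm u = 1 \<Longrightarrow> ?q v \<le> ?q u" by auto
  define m where "m = ?q v"
  have m_le: "m * (u \<bullet> u) \<le> ?q u" for u
  proof (cases "u = 0")
    case False
    define n where "n = norm u"
    have n: "n > 0" using False by (simp add: n_def)
    have "m \<le> ?q ((1 / n) *\<^sub>R u)" unfolding m_def using n by (intro v_min) (simp add: n_def)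
    also have "\<dots> = ?q u / n\<^sup>2" by (simp add: matrix_vector_mult_scaleR power2_eq_square)
    finally show ?thesis using n by (simp add: field_simps n_def power2_norm_eq_inner)
  qed auto
  define M' where "M' = M - diagonal (\<lambda>_. m)"
  have D: "diagonal (\<lambda>_. m) *v u = m *\<^sub>R u" for u :: "real^'n"
    by (simp add: vec_eq_iff)
  have M': "M' *v u = M *v u - m *\<^sub>R u" for u
    by (simp add: M'_def matrix_vector_mult_diff_rdistrib D)
  have "M' *v v = 0"
  proof (rule symmetric_psd_kernel)
    show "transpose M' = M'"
      using sym by (auto simp: M'_def transpose_def diagonal_def vec_eq_iff)
    show "u \<bullet> (M' *v u) \<ge> 0" for u using m_le[of u] by (simp add: M' inner_diff_right)
    show "v \<bullet> (M' *v v) = 0"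
      using v by (simp add: M' inner_diff_right m_def norm_eq_1)
  qed
  then have "is_eigenvalue M m"
    unfolding is_eigenvalue_def using v by (intro exI[of _ v]) (auto simp: M')
  moreover have "m \<le> a" if a: "is_eigenvalue M a" for a
  proof -
    obtain w where w: "w \<noteq> 0" "M *v w = a *\<^sub>R w" using a by (auto simp: is_eigenvalue_def)
    have "m * (w \<bullet> w) \<le> a * (w \<bullet> w)" using m_le[of w] w by simp
    then show ?thesis using w(1) by simp
  qed
  ultimately have "least_eigenvalue M = m"
    unfolding least_eigenvalue_def by (rule Least_equality)
  then show ?thesis using m_le by simp
qed

text \<open>Substituting \<open>v = d^(1/2) s\<close> turns the Euclidean Rayleigh bound for the
  scaled matrix into a bound for \<open>K\<close> relative to the energy form of
  \<open>diagonal d\<close>.\<close>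

lemma scaled_least_eigenvalue_le:
  fixes K :: "real^'n^'n"
  assumes sym: "transpose K = K" and d: "\<And>i. d i > 0"
  defines "D \<equiv> diagonal (\<lambda>i. d i powr (- 1 / 2))"
  shows "least_eigenvalue (D ** K ** D) * (s \<bullet> (diagonal d *v s)) \<le> s \<bullet> (K *v s)"
proof -
  define v where "v = diagonal (\<lambda>i. d i powr (1 / 2)) *v s"
  have Dv: "D *v v = s"
    using d by (simp add: vec_eq_iff D_def v_def mult.assoc[symmetric] powr_add[symmetric] less_imp_neq[symmetric])
  have "v \<bullet> v = s \<bullet> (diagonal d *v s)"
    unfolding inner_vec_def
  proof (rule sum.cong)
    fix i
    have "v $ i * v $ i = (d i powr (1 / 2) * d i powr (1 / 2)) * (s $ i * s $ i)"
      by (simp add: v_def)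
    also have "d i powr (1 / 2) * d i powr (1 / 2) = d i"
      using d[of i] by (simp add: powr_add[symmetric])
    finally show "v $ i \<bullet> v $ i = s $ i \<bullet> (diagonal d *v s) $ i" by simp
  qed simp
  moreover have "v \<bullet> ((D ** K ** D) *v v) = s \<bullet> (K *v s)"
    by (simp only: matrix_vector_mul_assoc[symmetric] Dv
        diagonal_self_adjoint[of v "\<lambda>i. d i powr (- 1 / 2)", folded D_def])
  moreover have "transpose (D ** K ** D) = D ** K ** D"
    using sym by (simp add: D_def matrix_transpose_mul matrix_mul_assoc)
  ultimately show ?thesis using least_eigenvalue_le by metis
qed

section \<open>The Brayton--Moser Lyapunov function\<close>

lemma has_vector_derivative_chain:
  assumes "(x has_vector_derivative w) (at t)" and "(f has_derivative D) (at (x t))"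
  shows "((\<lambda>t. f (x t)) has_vector_derivative D w) (at t)"
  using vector_derivative_diff_chain_within[OF assms(1) has_derivative_at_withinI[OF assms(2)]]
  by (simp add: o_def)

text \<open>\<open>w\<close> and \<open>s\<close> are the velocities, written through the state:
  this makes them differentiable by the chain rule although \<open>x\<close> and \<open>y\<close>
  are only assumed differentiable once. The quantity shown to vanish is twice the energy of the
  velocities.\<close>

lemma brayton_moser:
  fixes x :: "real \<Rightarrow> 'a::euclidean_space" and y :: "real \<Rightarrow> 'b::euclidean_space"
    and C Ci :: "'a \<Rightarrow> 'a" and L Li :: "'b \<Rightarrow> 'b" and B :: "'b \<Rightarrow> 'a" and B' :: "'a \<Rightarrow> 'b"
    and f :: "'a \<Rightarrow> 'a" and g :: "'b \<Rightarrow> 'b"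
  defines "w \<equiv> \<lambda>t. Ci (- f (x t) - B (y t))" and "s \<equiv> \<lambda>t. Li (B' (x t) - g (y t))"
  assumes lin: "bounded_linear C" "bounded_linear Ci" "bounded_linear L" "bounded_linear Li"
      "bounded_linear B" "bounded_linear B'"
    and inv: "\<And>u. C (Ci u) = u" "\<And>u. L (Li u) = u"
    and sym: "\<And>u v. u \<bullet> C v = C u \<bullet> v" "\<And>u v. u \<bullet> L v = L u \<bullet> v"
    and adj: "\<And>u v. u \<bullet> B v = B' u \<bullet> v"
    and pos: "\<And>u. u \<bullet> C u \<ge> 0" "\<And>u. u \<bullet> L u \<ge> 0"
    and f: "\<And>u. (f has_derivative Df u) (at u)" and g: "\<And>u. (g has_derivative Dg u) (at u)"
    and a: "\<And>u. (a has_derivative (\<lambda>h. f u \<bullet> h)) (at u)"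
    and b: "\<And>u. (b has_derivative (\<lambda>h. g u \<bullet> h)) (at u)"
    and mono: "\<And>u h. \<mu> * (h \<bullet> C h) \<le> h \<bullet> Df u h" "\<And>u h. \<nu> * (h \<bullet> L h) \<le> h \<bullet> Dg u h"
    and mu: "\<nu> + \<mu> > 0"
    and x: "\<And>t. t > 0 \<Longrightarrow> (x has_vector_derivative w t) (at t)"
    and y: "\<And>t. t > 0 \<Longrightarrow> (y has_vector_derivative s t) (at t)"
    and bd: "bounded (x ` {0<..})" "bounded (y ` {0<..})"
  shows "((\<lambda>t. w t \<bullet> C (w t) + s t \<bullet> L (s t)) \<longlongrightarrow> 0) at_top"
proof -
  define e where "e t = w t \<bullet> C (w t) + s t \<bullet> L (s t)" for t
  define e' where "e' t = - 2 * (w t \<bullet> Df (x t) (w t) + s t \<bullet> Dg (y t) (s t))" for t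
  \<comment> \<open>The mixed potential of the circuit; along solutions its derivative has the dissipation of
    the two branch kinds with opposite signs, and the multiple \<open>l\<close> balances them in \<open>e / 2 + l * p\<close>.\<close>
  define P where "P = (\<lambda>(u, v). a u - b v + u \<bullet> B v)"
  define p where "p t = P (x t, y t)" for t
  define p' where "p' t = s t \<bullet> L (s t) - w t \<bullet> C (w t)" for t
  define l where "l = (\<nu> - \<mu>) / 2"
  have Cw: "C (w t) = - f (x t) - B (y t)" and Ls: "L (s t) = B' (x t) - g (y t)" for t
    by (simp_all add: w_def s_def inv)
  have dB: "((\<lambda>t. B (y t)) has_vector_derivative B (s t)) (at t)"
    and dB': "((\<lambda>t. B' (x t)) has_vector_derivative B' (w t)) (at t)" if "t > 0" for t
    using bounded_linear.has_vector_derivative[OF lin(5) y[OF that]]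
      bounded_linear.has_vector_derivative[OF lin(6) x[OF that]] by auto
  have e: "(e has_real_derivative e' t) (at t)" if t: "t > 0" for t
  proof -
    define c' where "c' = - Df (x t) (w t) - B (s t)"
    define d' where "d' = B' (w t) - Dg (y t) (s t)"
    have w': "(w has_vector_derivative Ci c') (at t)"
      unfolding w_def c'_def
      by (intro bounded_linear.has_vector_derivative[OF lin(2)] has_vector_derivative_diff
          has_vector_derivative_minus has_vector_derivative_chain[OF _ f] dB[OF t]
          x[OF t, unfolded w_def])
    have s': "(s has_vector_derivative Li d') (at t)"
      unfolding s_def d'_def
      by (intro bounded_linear.has_vector_derivative[OF lin(4)] has_vector_derivative_diff
          has_vector_derivative_chain[OF _ g] dB'[OF t] y[OF t, unfolded s_def])
    have "(e has_vector_derivative (w t \<bullet> C (Ci c') + Ci c' \<bullet> C (w t))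
        + (s t \<bullet> L (Li d') + Li d' \<bullet> L (s t))) (at t)"
      unfolding e_def
      by (intro has_vector_derivative_add w' s'
          bounded_bilinear.has_vector_derivative[OF bounded_bilinear_inner]
          bounded_linear.has_vector_derivative[OF lin(1)]
          bounded_linear.has_vector_derivative[OF lin(3)])
    also have "(w t \<bullet> C (Ci c') + Ci c' \<bullet> C (w t)) + (s t \<bullet> L (Li d') + Li d' \<bullet> L (s t)) = e' t"
    proof -
      have "Ci c' \<bullet> C (w t) = w t \<bullet> c'" "Li d' \<bullet> L (s t) = s t \<bullet> d'"
        by (simp_all add: sym inv inner_commute)
      \<comment> \<open>The coupling of the two branch kinds is skew, so its contributions to the
        energy balance cancel and only the dissipation through \<open>Df\<close> and
        \<open>Dg\<close> remains.\<close>
      moreover have "w t \<bullet> B (s t) = s t \<bullet> B' (w t)" by (simp add: adj inner_commute)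
      then have "w t \<bullet> c' + s t \<bullet> d' = - (w t \<bullet> Df (x t) (w t) + s t \<bullet> Dg (y t) (s t))"
        by (simp add: c'_def d'_def inner_diff_right)
      ultimately show ?thesis by (simp add: inv e'_def)
    qed
    finally show ?thesis by (simp add: has_real_derivative_iff_has_vector_derivative)
  qed
  have p: "(p has_real_derivative p' t) (at t)" if t: "t > 0" for t
  proof -
    have "(p has_vector_derivative (f (x t) \<bullet> w t - g (y t) \<bullet> s t)
        + (x t \<bullet> B (s t) + w t \<bullet> B (y t))) (at t)"
      unfolding p_def P_def prod.case
      by (intro has_vector_derivative_add has_vector_derivative_diff
          has_vector_derivative_chain[OF x a] has_vector_derivative_chain[OF y b]
          bounded_bilinear.has_vector_derivative[OF bounded_bilinear_inner] x dB t)
    moreover have "x t \<bullet> B (s t) = s t \<bullet> B' (x t)" by (simp add: adj inner_commute)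
    ultimately show ?thesis
      by (simp add: has_real_derivative_iff_has_vector_derivative p'_def Cw Ls
          inner_diff_right inner_commute algebra_simps)
  qed
  have e'_le: "e' t \<le> - 2 * (\<mu> * (w t \<bullet> C (w t)) + \<nu> * (s t \<bullet> L (s t)))" for t
    using mono(1)[of "w t" "x t"] mono(2)[of "s t" "y t"] by (simp add: e'_def)
  \<comment> \<open>Adding \<open>l * p\<close> replaces both decay rates by their mean:
    \<open>\<mu> + l\<close> and \<open>\<nu> - l\<close> both equal
    \<open>(\<nu> + \<mu>) / 2\<close>. One of the two rates may be negative, so \<open>e\<close>
    alone may grow; the absolute values in \<open>K\<close> bound that growth.\<close>
  have "(e \<longlongrightarrow> 0) at_top"
  proof (rule tendsto_0_of_dissipation[where K = "2 * (\<bar>\<nu>\<bar> + \<bar>\<mu>\<bar>)" and c = "(\<nu> + \<mu>) / 2"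
        and w = "\<lambda>t. e t / 2 + l * p t" and w' = "\<lambda>t. e' t / 2 + l * p' t"])
    fix t :: real assume t: "t > 0"
    show "(e has_real_derivative e' t) (at t)" by (rule e[OF t])
    show "((\<lambda>t. e t / 2 + l * p t) has_real_derivative e' t / 2 + l * p' t) (at t)"
      using e[OF t] p[OF t] by (auto intro!: derivative_eq_intros)
    have "- (\<mu> * (w t \<bullet> C (w t))) \<le> (\<bar>\<nu>\<bar> + \<bar>\<mu>\<bar>) * (w t \<bullet> C (w t))"
      "- (\<nu> * (s t \<bullet> L (s t))) \<le> (\<bar>\<nu>\<bar> + \<bar>\<mu>\<bar>) * (s t \<bullet> L (s t))"
      using mult_right_mono[OF _ pos(1), of "- \<mu>" "\<bar>\<nu>\<bar> + \<bar>\<mu>\<bar>" "w t"]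
        mult_right_mono[OF _ pos(2), of "- \<nu>" "\<bar>\<nu>\<bar> + \<bar>\<mu>\<bar>" "s t"] by auto
    then show "e' t \<le> 2 * (\<bar>\<nu>\<bar> + \<bar>\<mu>\<bar>) * e t"
      using e'_le[of t] by (simp add: e_def algebra_simps)
    show "e' t / 2 + l * p' t \<le> - ((\<nu> + \<mu>) / 2) * e t"
      using e'_le[of t] by (simp add: e_def p'_def l_def field_simps)
    show "e t \<ge> 0" using pos by (simp add: e_def)
  next
    \<comment> \<open>The mixed potential has no sign; it is bounded along the solution because it
      is continuous and the closures of the two trajectories are compact. The energy
      \<open>e\<close> is bounded below by 0.\<close>
    have "continuous_on UNIV a" "continuous_on UNIV b" "continuous_on UNIV B"
      using has_derivative_continuous_on[OF a] has_derivative_continuous_on[OF b]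
        linear_continuous_on[OF lin(5)] by auto
    then have "continuous_on UNIV P"
      unfolding P_def case_prod_beta
      by (auto intro!: continuous_intros intro: continuous_on_compose2)
    moreover have "compact (closure (x ` {0<..}) \<times> closure (y ` {0<..}))"
      using bd by (intro compact_Times) (simp_all add: compact_closure)
    ultimately have "bounded (P ` (closure (x ` {0<..}) \<times> closure (y ` {0<..})))"
      using compact_continuous_image continuous_on_subset compact_imp_bounded by blast
    then obtain M where M: "\<And>q. q \<in> closure (x ` {0<..}) \<times> closure (y ` {0<..}) \<Longrightarrow> \<bar>P q\<bar> \<le> M"
      by (auto simp: bounded_iff)
    show "bdd_below ((\<lambda>t. e t / 2 + l * p t) ` {0<..})"
    proof (rule bdd_belowI2)
      fix t :: real assume "t \<in> {0<..}"
      then have "\<bar>p t\<bar> \<le> M" unfolding p_def by (intro M) (auto intro: closure_subset[THEN subsetD])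
      then have "\<bar>l * p t\<bar> \<le> \<bar>l\<bar> * M" by (simp add: abs_mult mult_left_mono)
      moreover have "e t \<ge> 0" using pos by (simp add: e_def)
      ultimately show "- (\<bar>l\<bar> * M) \<le> e t / 2 + l * p t" by linarith
    qed
  qed (use mu in auto)
  then show ?thesis by (simp add: e_def[abs_def])
qed

section \<open>Memristive branches\<close>

lemma memristor_DERIV:
  assumes "memristor_characteristic q"
  shows "(q has_real_derivative deriv q x) (at x)"
  using assms unfolding memristor_characteristic_def C1_differentiable_on_def
  by (metis DERIV_imp_deriv UNIV_I has_real_derivative_iff_has_vector_derivative)

text \<open>Integration over the whole extended line yields a single antiderivative valid at every
  real point. It supplies the nonlinear part of the branch potential.\<close>

lemma memristor_antiderivative:
  assumes "memristor_characteristic q"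
  obtains F where "\<And>x. (F has_real_derivative q x) (at x)"
proof -
  have "isCont q x" for x using memristor_DERIV[OF assms] DERIV_isCont by blast
  then show thesis
    using einterval_antiderivative[of "-\<infinity>" "\<infinity>" q] that
    by (auto simp: has_real_derivative_iff_has_vector_derivative)
qed

text \<open>Nonnegativity of the derivative provides the lower bound without which an infimum of
  reals would be unspecified.\<close>

lemma memristor_Inf_deriv_le:
  assumes "memristor_characteristic q"
  shows "(INF u. deriv q u) \<le> deriv q x"
  using assms by (intro cINF_lower bdd_belowI2[of _ 0]) (auto simp: memristor_characteristic_def)

lemma has_derivative_componentwise_map:
  fixes q :: "'n::finite \<Rightarrow> real \<Rightarrow> real"
  assumes "\<And>i x. (q i has_real_derivative q' i x) (at x)"
  shows "((\<lambda>u. \<chi> i. q i (u $ i)) has_derivative (\<lambda>h. \<chi> i. q' i (u $ i) * h $ i)) (at u)"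
proof (subst has_derivative_componentwise_within, rule ballI)
  fix e :: "real^'n" assume "e \<in> Basis"
  then have "\<exists>i. e = axis i 1" by (simp add: Basis_vec_def)
  then obtain i where e: "e = axis i 1" ..
  have "((\<lambda>u. u $ i) has_derivative (\<lambda>h. h $ i)) (at u)"
    by (rule bounded_linear_imp_has_derivative) (rule bounded_linear_vec_nth)
  from has_derivative_compose[OF this assms[unfolded has_field_derivative_def]]
  show "((\<lambda>u. (\<chi> i. q i (u $ i)) \<bullet> e) has_derivative (\<lambda>h. (\<chi> i. q' i (u $ i) * h $ i) \<bullet> e)) (at u)"
    by (simp add: e inner_axis)
qed

lemma separable_potential:
  fixes q :: "'n::finite \<Rightarrow> real \<Rightarrow> real"
  assumes "\<And>i x. (F i has_real_derivative q i x) (at x)"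
  shows "((\<lambda>u. \<Sum>i\<in>UNIV. F i (u $ i)) has_derivative (\<lambda>h. (\<chi> i. q i (u $ i)) \<bullet> h)) (at u)"
proof -
  have "((\<lambda>u. F i (u $ i)) has_derivative (\<lambda>h. q i (u $ i) * h $ i)) (at u)" for i
  proof -
    have "((\<lambda>u. u $ i) has_derivative (\<lambda>h. h $ i)) (at u)"
      by (rule bounded_linear_imp_has_derivative) (rule bounded_linear_vec_nth)
    from has_derivative_compose[OF this assms[unfolded has_field_derivative_def]]
    show ?thesis .
  qed
  then have "((\<lambda>u. \<Sum>i\<in>UNIV. F i (u $ i)) has_derivative
      (\<lambda>h. \<Sum>i\<in>UNIV. q i (u $ i) * h $ i)) (at u)"
    by (intro has_derivative_sum)
  then show ?thesis by (simp add: inner_vec_def)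
qed

text \<open>Capacitive and inductive branches have the same form, with \<open>K\<close> the
  resistive block and \<open>k\<close> the constant vector, so the hypotheses of
  \<open>brayton_moser\<close> on \<open>f\<close> and on \<open>g\<close> are both obtained from
  here.\<close>

lemma memristive_branches:
  fixes K :: "real^'n^'n" and q :: "'n \<Rightarrow> real \<Rightarrow> real" and k :: "real^'n"
  defines "f \<equiv> \<lambda>u. K *v u + (\<chi> i. q i (u $ i)) - k"
    and "Df \<equiv> \<lambda>u h. K *v h + (\<chi> i. deriv (q i) (u $ i) * h $ i)"
    and "\<rho> \<equiv> \<lambda>i. INF x. deriv (q i) x"
  assumes sym: "transpose K = K" and q: "\<And>i. memristor_characteristic (q i)"
  shows memristive_branches_deriv: "(f has_derivative Df u) (at u)"
    and memristive_branches_potential: "\<exists>a. \<forall>u. (a has_derivative (\<lambda>h. f u \<bullet> h)) (at u)"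
    and memristive_branches_mono: "(\<And>i. d i > 0) \<Longrightarrow>
      least_eigenvalue (diagonal (\<lambda>i. d i powr (- 1 / 2)) ** (K + diagonal \<rho>)
        ** diagonal (\<lambda>i. d i powr (- 1 / 2))) * (h \<bullet> (diagonal d *v h)) \<le> h \<bullet> Df u h"
proof -
  have K: "((*v) K has_derivative (*v) K) (at u)" for u
    by (rule bounded_linear_imp_has_derivative) simp
  show "(f has_derivative Df u) (at u)"
    unfolding f_def Df_def
    using has_derivative_diff[OF has_derivative_add[OF K
          has_derivative_componentwise_map[OF memristor_DERIV[OF q]]] has_derivative_const[of k]]
    by simp
  have K_sym: "u \<bullet> (K *v h) = (K *v u) \<bullet> h" for u h
    using sym by (metis dot_lmul_matrix vector_transpose_matrix)
  have "\<exists>F. \<forall>x. (F has_real_derivative q i x) (at x)" for i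
    using memristor_antiderivative[OF q[of i]] by blast
  then obtain F where F: "\<And>i x. (F i has_real_derivative q i x) (at x)" by metis
  \<comment> \<open>Symmetry of \<open>K\<close> makes \<open>K *v u\<close> the gradient of half
    its quadratic form; the memristors contribute the sum of their antiderivatives and
    \<open>k\<close> a linear term.\<close>
  have "((\<lambda>u. (u \<bullet> (K *v u)) / 2 + (\<Sum>i\<in>UNIV. F i (u $ i)) - k \<bullet> u) has_derivative
      (\<lambda>h. f u \<bullet> h)) (at u)" for u
  proof (rule has_derivative_eq_rhs)
    show "((\<lambda>u. (u \<bullet> (K *v u)) / 2 + (\<Sum>i\<in>UNIV. F i (u $ i)) - k \<bullet> u) has_derivative
      (\<lambda>h. (u \<bullet> (K *v h) + h \<bullet> (K *v u)) / 2 + (\<chi> i. q i (u $ i)) \<bullet> h - k \<bullet> h)) (at u)"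
      by (intro has_derivative_diff has_derivative_add separable_potential F
          bounded_linear.has_derivative[OF bounded_linear_divide]
          has_derivative_inner_right has_derivative_inner has_derivative_ident K)
  qed (simp add: f_def K_sym[of u] inner_commute[of _ "K *v u"] inner_add_left inner_diff_left fun_eq_iff)
  then show "\<exists>a. \<forall>u. (a has_derivative (\<lambda>h. f u \<bullet> h)) (at u)" by blast
  assume d: "\<And>i. d i > 0"
  have "transpose (K + diagonal \<rho>) = K + diagonal \<rho>"
    using sym by (auto simp: transpose_def diagonal_def vec_eq_iff)
  note scaled_least_eigenvalue_le[OF this, of d h, OF d]
  moreover have "h \<bullet> ((K + diagonal \<rho>) *v h) \<le> h \<bullet> Df u h"
  proof -
    have "h $ i * (\<rho> i * h $ i) \<le> h $ i * (deriv (q i) (u $ i) * h $ i)" for i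
      using mult_right_mono[OF memristor_Inf_deriv_le[OF q, of i "u $ i"], of "h $ i * h $ i"]
      by (simp add: \<rho>_def algebra_simps)
    then have "h \<bullet> (diagonal \<rho> *v h) \<le> h \<bullet> (\<chi> i. deriv (q i) (u $ i) * h $ i)"
      by (simp add: inner_vec_def sum_mono)
    then show ?thesis by (simp add: Df_def matrix_vector_mult_add_rdistrib inner_add_right)
  qed
  ultimately show "least_eigenvalue (diagonal (\<lambda>i. d i powr (- 1 / 2)) ** (K + diagonal \<rho>)
        ** diagonal (\<lambda>i. d i powr (- 1 / 2))) * (h \<bullet> (diagonal d *v h)) \<le> h \<bullet> Df u h"
    by (rule order_trans)
qed

section \<open>Symmetry of the resistive blocks and convergence of the circuit trajectories\<close>

lemma transpose_H_aa: "transpose (H_aa N T) = H_aa N T"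
  by (simp add: transpose_def H_aa_def vec_eq_iff mult_ac)

lemma transpose_H_bb: "transpose (H_bb N T) = H_bb N T"
  by (simp add: transpose_def H_bb_def vec_eq_iff mult_ac)

theorem theorem6:
  fixes N :: "('v, 'c::finite, 'l::finite, 'r) circuit"
    and T :: "('c, 'l, 'r) branch set"
    and v\<^sub>C\<^sub>0 \<Phi>\<^sub>M\<^sub>C\<^sub>0 Q\<^sub>0 :: "real^'c"
    and i\<^sub>L\<^sub>0 Q\<^sub>M\<^sub>L\<^sub>0 \<Phi>\<^sub>0 :: "real^'l"
    and z :: "real \<Rightarrow> (real^'c) \<times> (real^'l)"
  assumes "is_circuit N" and "is_circuit_tree N T"
    and "mu1 N T + mu2 N T > 0"
    and "Q\<^sub>0 = Q_const N T v\<^sub>C\<^sub>0 \<Phi>\<^sub>M\<^sub>C\<^sub>0 Q\<^sub>M\<^sub>L\<^sub>0"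
    and "\<Phi>\<^sub>0 = Phi_const N T i\<^sub>L\<^sub>0 \<Phi>\<^sub>M\<^sub>C\<^sub>0 Q\<^sub>M\<^sub>L\<^sub>0"
    and "is_solution N T (Q\<^sub>0, \<Phi>\<^sub>0) z" and "bounded (z ` {0..})"
  shows "converges_to_set z (equilibria N T (Q\<^sub>0, \<Phi>\<^sub>0)) \<and>
    (discrete (equilibria N T (Q\<^sub>0, \<Phi>\<^sub>0)) \<longrightarrow>
      (\<exists>e \<in> equilibria N T (Q\<^sub>0, \<Phi>\<^sub>0). (z \<longlongrightarrow> e) at_top))"
proof -
  have cap: "\<And>i. capacitance N i > 0" and ind: "\<And>j. inductance N j > 0"
    and qC: "\<And>i. memristor_characteristic (Q_hat N i)"
    and qL: "\<And>j. memristor_characteristic (Phi_hat N j)"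
    using assms(1) by (auto simp: is_circuit_def)
  define C Ci where "C = diagonal (capacitance N)"
    and "Ci = diagonal (\<lambda>i. inverse (capacitance N i))"
  define L Li where "L = diagonal (inductance N)"
    and "Li = diagonal (\<lambda>j. inverse (inductance N j))"
  define f where "f u = H_aa N T *v u + (\<chi> i. Q_hat N i (u $ i)) - Q\<^sub>0" for u
  define g where "g v = H_bb N T *v v + (\<chi> j. Phi_hat N j (v $ j)) - \<Phi>\<^sub>0" for v
  define x y where "x t = fst (z t)" and "y t = snd (z t)" for t
  define F1 F2 where "F1 p = - f (fst p) - H_ab N T *v snd p"
    and "F2 p = transpose (H_ab N T) *v fst p - g (snd p)" for p
  \<comment> \<open>\<open>W\<close> is twice the energy of the velocities as a function of the
    state: for \<open>w = Ci *v F1 p\<close>, the form \<open>w \<bullet> (C *v w)\<close> becomes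
    \<open>(Ci *v F1 p) \<bullet> F1 p\<close>. By positive definiteness its zeros are exactly the
    equilibria, which allows the cluster point lemmas to be applied to it.\<close>
  define W where "W p = (Ci *v F1 p) \<bullet> F1 p + (Li *v F2 p) \<bullet> F2 p" for p
  have CCi: "C *v (Ci *v u) = u" "Ci *v (C *v u) = u" for u
    using diagonal_inverse_mult[OF cap] by (simp_all add: C_def Ci_def)
  have LLi: "L *v (Li *v u) = u" "Li *v (L *v u) = u" for u
    using diagonal_inverse_mult[OF ind] by (simp_all add: L_def Li_def)
  have rhs: "state_rhs N T (Q\<^sub>0, \<Phi>\<^sub>0) p = (F1 p, F2 p)" for p
  proof -
    have "(- transpose (H_ab N T)) *v u = - (transpose (H_ab N T) *v u)" for u
      by (simp add: matrix_vector_mult_def vec_eq_iff sum_negf)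
    then show ?thesis
      by (cases p) (simp add: state_rhs_def H_mult_def F1_def F2_def f_def g_def Q_MC_def
          Phi_ML_def)
  qed
  have zeros: "{p. W p = 0} = equilibria N T (Q\<^sub>0, \<Phi>\<^sub>0)"
  proof -
    have "W p = 0 \<longleftrightarrow> F1 p = 0 \<and> F2 p = 0" for p
      unfolding W_def Ci_def Li_def inner_commute[of "_ *v _"]
      using cap ind
      by (subst add_nonneg_eq_0_iff)
        (auto intro!: diagonal_quadratic_form_ge_0 simp: diagonal_quadratic_form_eq_0_iff)
    then show ?thesis by (auto simp: equilibria_def rhs zero_prod_def)
  qed
  have z': "(z has_vector_derivative (Ci *v F1 (z t), Li *v F2 (z t))) (at t within {0..})"
    if t: "t \<ge> 0" for t
  proof -
    obtain a b where ab: "(z has_vector_derivative (a, b)) (at t within {0..})"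
      "C *v a = F1 (z t)" "L *v b = F2 (z t)"
      using assms(6) t by (auto simp: is_solution_def rhs C_def L_def)
    then have "Ci *v F1 (z t) = a" "Li *v F2 (z t) = b" using CCi(2) LLi(2) by metis+
    then show ?thesis using ab(1) by simp
  qed
  \<comment> \<open>At time 0 the derivative is only one-sided, so the Lyapunov argument runs over
    positive times, where it is two-sided.\<close>
  have z'_at: "(z has_vector_derivative (Ci *v F1 (z t), Li *v F2 (z t))) (at t)" if "t > 0" for t
  proof -
    have "{0<..} \<subseteq> {0::real..}" by auto
    from has_vector_derivative_within_subset[OF z' this, of t] show ?thesis
      using that by (simp add: at_within_open[OF _ open_greaterThan])
  qed
  have z: "continuous_on {0..} z"
    unfolding continuous_on_eq_continuous_within
    by (auto intro: has_vector_derivative_continuous z')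
  define Df Dg
    where "Df u h = H_aa N T *v h + (\<chi> i. deriv (Q_hat N i) (u $ i) * h $ i)"
      and "Dg v k = H_bb N T *v k + (\<chi> j. deriv (Phi_hat N j) (v $ j) * k $ j)" for u v h k
  have f: "(f has_derivative Df u) (at u)" for u
    unfolding f_def[abs_def] Df_def[abs_def]
    by (rule memristive_branches_deriv[OF transpose_H_aa qC])
  have g: "(g has_derivative Dg v) (at v)" for v
    unfolding g_def[abs_def] Dg_def[abs_def]
    by (rule memristive_branches_deriv[OF transpose_H_bb qL])
  have "\<exists>a. \<forall>u. (a has_derivative (\<lambda>h. f u \<bullet> h)) (at u)"
    unfolding f_def by (rule memristive_branches_potential[OF transpose_H_aa qC])
  then obtain a where a: "\<And>u. (a has_derivative (\<lambda>h. f u \<bullet> h)) (at u)" by blast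
  have "\<exists>b. \<forall>v. (b has_derivative (\<lambda>h. g v \<bullet> h)) (at v)"
    unfolding g_def by (rule memristive_branches_potential[OF transpose_H_bb qL])
  then obtain b where b: "\<And>v. (b has_derivative (\<lambda>h. g v \<bullet> h)) (at v)" by blast
  have mono_f: "mu2 N T * (h \<bullet> (C *v h)) \<le> h \<bullet> Df u h" for u h
    unfolding mu2_def Let_def C_def rho_M_def[abs_def] Df_def
    by (rule memristive_branches_mono[OF transpose_H_aa qC cap])
  have mono_g: "mu1 N T * (h \<bullet> (L *v h)) \<le> h \<bullet> Dg v h" for v h
    unfolding mu1_def Let_def L_def gamma_M_def[abs_def] Dg_def
    by (rule memristive_branches_mono[OF transpose_H_bb qL ind])
  define w s where "w t = Ci *v (- f (x t) - H_ab N T *v y t)"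
    and "s t = Li *v (transpose (H_ab N T) *v x t - g (y t))" for t
  have "((\<lambda>t. w t \<bullet> (C *v w t) + s t \<bullet> (L *v s t)) \<longlongrightarrow> 0) at_top"
    unfolding w_def s_def
  proof (rule brayton_moser[where C = "(*v) C" and Ci = "(*v) Ci" and L = "(*v) L"
        and Li = "(*v) Li" and B = "(*v) (H_ab N T)" and B' = "(*v) (transpose (H_ab N T))"
        and f = f and g = g and a = a and b = b and x = x and y = y and Df = Df and Dg = Dg
        and \<nu> = "mu1 N T" and \<mu> = "mu2 N T"])
    \<comment> \<open>The off-diagonal blocks of \<open>H\<close> are negative transposes of each
      other, which is the skew coupling that the energy balance relies on.\<close>
    show "u \<bullet> (H_ab N T *v v) = (transpose (H_ab N T) *v u) \<bullet> v" for u v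
      by (simp add: dot_lmul_matrix transpose_matrix_vector)
    show "(x has_vector_derivative Ci *v (- f (x t) - H_ab N T *v y t)) (at t)" if "t > 0" for t
      using bounded_linear.has_vector_derivative[OF bounded_linear_fst z'_at[OF that]]
      by (simp add: x_def[abs_def] y_def F1_def)
    show "(y has_vector_derivative Li *v (transpose (H_ab N T) *v x t - g (y t))) (at t)"
      if "t > 0" for t
      using bounded_linear.has_vector_derivative[OF bounded_linear_snd z'_at[OF that]]
      by (simp add: x_def y_def[abs_def] F2_def)
    have "bounded (z ` {0<..})" by (rule bounded_subset[OF assms(7)]) auto
    then have "bounded (fst ` z ` {0<..})" "bounded (snd ` z ` {0<..})"
      by (rule bounded_fst, rule bounded_snd)
    then show "bounded (x ` {0<..})" "bounded (y ` {0<..})"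
      by (simp_all add: x_def y_def image_image)
    show "u \<bullet> (C *v v) = (C *v u) \<bullet> v" for u v
      unfolding C_def by (rule diagonal_self_adjoint)
    show "u \<bullet> (L *v v) = (L *v u) \<bullet> v" for u v
      unfolding L_def by (rule diagonal_self_adjoint)
    show "u \<bullet> (C *v u) \<ge> 0" for u
      unfolding C_def by (rule diagonal_quadratic_form_ge_0[OF cap])
    show "u \<bullet> (L *v u) \<ge> 0" for u
      unfolding L_def by (rule diagonal_quadratic_form_ge_0[OF ind])
  qed (fact f g a b mono_f mono_g assms(3) CCi(1) LLi(1) matrix_vector_mul_bounded_linear)+
  then have W_lim: "((\<lambda>t. W (z t)) \<longlongrightarrow> 0) at_top"
    by (simp add: W_def F1_def F2_def w_def s_def x_def y_def CCi LLi)
  have "continuous_on UNIV f" "continuous_on UNIV g"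
    using has_derivative_continuous_on[OF f] has_derivative_continuous_on[OF g] by auto
  then have fg: "continuous_on UNIV (\<lambda>p :: (real^'c) \<times> (real^'l). f (fst p))"
      "continuous_on UNIV (\<lambda>p :: (real^'c) \<times> (real^'l). g (snd p))"
    using continuous_on_compose2[OF _ continuous_on_fst[OF continuous_on_id], of UNIV f]
      continuous_on_compose2[OF _ continuous_on_snd[OF continuous_on_id], of UNIV g] by auto
  have F_cont: "continuous_on UNIV F1" "continuous_on UNIV F2"
    unfolding F1_def[abs_def] F2_def[abs_def]
    by (rule continuous_on_diff continuous_on_minus fg
        bounded_linear.continuous_on[OF matrix_vector_mul_bounded_linear]
        continuous_on_fst continuous_on_snd continuous_on_id)+
  have W_cont: "continuous_on UNIV W"
    unfolding W_def[abs_def]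
    by (rule continuous_on_add continuous_on_inner F_cont
        bounded_linear.continuous_on[OF matrix_vector_mul_bounded_linear])+
  show ?thesis
  proof (intro conjI impI)
    show "converges_to_set z (equilibria N T (Q\<^sub>0, \<Phi>\<^sub>0))"
      using converges_to_zeros[OF assms(7) W_cont W_lim] by (simp only: zeros)
    assume "discrete (equilibria N T (Q\<^sub>0, \<Phi>\<^sub>0))"
    then have "discrete {p. W p = 0}" by (simp only: zeros)
    from tendsto_isolated_zero[OF z assms(7) W_cont W_lim this]
    obtain e where "W e = 0" "(z \<longlongrightarrow> e) at_top" by blast
    moreover have "e \<in> equilibria N T (Q\<^sub>0, \<Phi>\<^sub>0)"
      unfolding zeros[symmetric] using \<open>W e = 0\<close> by simp
    ultimately show "\<exists>e\<in>equilibria N T (Q\<^sub>0, \<Phi>\<^sub>0). (z \<longlongrightarrow> e) at_top" by blast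
  qed
qed

end
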